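(* Let $X$ be a separable Banach space and let $\mu$ be a Borel probability measure on $X$ with a space of admissible shifts $H\subset X$. Suppose that $H$ possesses a dense continuously embedded subspace $(E, \|\cdot\|_E) \subset H$ such that for every $h\in E$ the density of $\mu_h$ with respect to $\mu$ has a continuous representative $\frac{\mathrm{d}\mu_h}{\mathrm{d}\mu} \in C(X)$. Let $\hat x \in X$ be a generalized mode of $\mu$. If (i) for every $\{\delta_n\}_{n \in \mathbb{N}} \subset (0,\infty)$ with $\delta_n \to 0$ there is an approximating sequence $\{w_n\}_{n \in \mathbb{N}} \subset \hat{x} + E$ (for $\hat x$ and $\{\delta_n\}_{n\in\mathbb{N}}$) with $\|w_n - \hat{x}\|_E \to 0$, and (ii) there is an $R > 0$ such that $$f_R:(E,\|\cdot\|_E)\to\mathbb{R},\qquad f_R(h) := \sup_{x \in B^R(\hat x)} \left|\frac{\mathrm{d}\mu_{h}}{\mathrm{d}\mu}(x) - 1\right|$$ is continuous at $0$, then $\hat x$ is a strong mode of $\mu$.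
   Context: Let $B^\delta(x) \subset X$ denote the open ball of radius $\delta$ around $x$, and for $\delta>0$ let $M^\delta := \sup_{x\in X}\mu(B^\delta(x))$. An element $h\in X$ is an admissible shift of $\mu$ if the shifted measure $\mu_h := \mu(\cdot - h)$ is equivalent to $\mu$ (mutually absolutely continuous). A point $\hat x\in X$ is a (strong) mode of $\mu$ if $\lim_{\delta\to 0} \mu(B^\delta(\hat x))/M^\delta = 1$. Given $\hat x\in X$ and a sequence $\{\delta_n\}_{n\in\mathbb{N}}\subset(0,\infty)$ with $\delta_n\to0$, an approximating sequence is a sequence $\{w_n\}_{n\in\mathbb{N}}\subset X$ with $w_n\to\hat x$ in $X$ and $\lim_{n\to\infty}\mu(B^{\delta_n}(w_n))/M^{\delta_n}=1$. The point $\hat x$ is a generalized mode of $\mu$ if for every sequence $\{\delta_n\}_{n\in\mathbb{N}}\subset(0,\infty)$ with $\delta_n\to 0$ such an approximating sequence exists. *)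

theory Defs
  imports "HOL-Probability.Probability"
begin

definition shifted_measure :: "'a::real_normed_vector measure \<Rightarrow> 'a \<Rightarrow> 'a measure" where
  "shifted_measure \<mu> h = distr \<mu> borel (\<lambda>x. x + h)"

lemma emeasure_shifted_measure:
  fixes \<mu> :: "'a::{real_normed_vector, second_countable_topology} measure"
  assumes "sets \<mu> = sets borel" "A \<in> sets borel"
  shows "emeasure (shifted_measure \<mu> h) A = emeasure \<mu> ((\<lambda>a. a - h) ` A)"
proof -
  have "(\<lambda>x. x + h) \<in> measurable \<mu> borel"
    using assms(1) by (simp cong: measurable_cong_sets)
  moreover have "(\<lambda>x. x + h) -` A \<inter> space \<mu> = (\<lambda>a. a - h) ` A"
    using sets_eq_imp_space_eq[OF assms(1)] by (force simp: image_iff)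
  ultimately show ?thesis
    using assms(2) by (simp add: shifted_measure_def emeasure_distr)
qed

definition admissible_shift :: "'a::real_normed_vector measure \<Rightarrow> 'a \<Rightarrow> bool" where
  "admissible_shift \<mu> h \<longleftrightarrow>
     absolutely_continuous \<mu> (shifted_measure \<mu> h) \<and>
     absolutely_continuous (shifted_measure \<mu> h) \<mu>"

(* The condition 0 \<le> r almost everywhere is needed because ennreal truncates negative
   values.  The function r is determined by this predicate only on the support of \<mu>;
   in particular the predicate does not force r = 1 off the support when h = 0. *)
definition continuous_shift_density ::
    "'a::real_normed_vector measure \<Rightarrow> 'a \<Rightarrow> ('a \<Rightarrow> real) \<Rightarrow> bool" where
  "continuous_shift_density \<mu> h r \<longleftrightarrow>
     continuous_on UNIV r \<and> (AE x in \<mu>. 0 \<le> r x) \<and>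
     density \<mu> (\<lambda>x. ennreal (r x)) = shifted_measure \<mu> h"

definition max_ball_mass :: "'a::real_normed_vector measure \<Rightarrow> real \<Rightarrow> real" where
  "max_ball_mass \<mu> \<delta> = (SUP x. measure \<mu> (ball x \<delta>))"

definition strong_mode :: "'a::real_normed_vector measure \<Rightarrow> 'a \<Rightarrow> bool" where
  "strong_mode \<mu> x \<longleftrightarrow>
     ((\<lambda>\<delta>. measure \<mu> (ball x \<delta>) / max_ball_mass \<mu> \<delta>) \<longlongrightarrow> 1) (at_right 0)"

definition approximating_sequence ::
    "'a::real_normed_vector measure \<Rightarrow> 'a \<Rightarrow> (nat \<Rightarrow> real) \<Rightarrow> (nat \<Rightarrow> 'a) \<Rightarrow> bool" where
  "approximating_sequence \<mu> x \<delta> w \<longleftrightarrow>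
     w \<longlonglongrightarrow> x \<and>
     (\<lambda>n. measure \<mu> (ball (w n) (\<delta> n)) / max_ball_mass \<mu> (\<delta> n)) \<longlonglongrightarrow> 1"

definition generalized_mode :: "'a::real_normed_vector measure \<Rightarrow> 'a \<Rightarrow> bool" where
  "generalized_mode \<mu> x \<longleftrightarrow>
     (\<forall>\<delta>. (\<forall>n. 0 < \<delta> n) \<longrightarrow> \<delta> \<longlonglongrightarrow> 0 \<longrightarrow> (\<exists>w. approximating_sequence \<mu> x \<delta> w))"

end

theory Submission
  imports Defs
begin

text \<open>
  Translating a ball is the same as shifting the measure: the mass of the ball around
  \<open>x0 + k\<close> is the \<open>\<mu>\<close>-integral over the ball around \<open>x0\<close> of the density of the measure shifted
  by \<open>-k\<close>.  If that density is within \<open>c\<close> of \<open>1\<close> near \<open>x0\<close>, then replacing an approximating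
  centre \<open>x0 + k\<close> by \<open>x0\<close> itself loses at most a factor \<open>1 + c\<close> of mass
  (\<open>measure_ball_translate_le\<close>).  Condition (i) says that the centres may be chosen with
  shifts tending to \<open>0\<close> in the norm of \<open>E\<close>, and condition (ii) says that the deviation \<open>c\<close> then
  tends to its value for the zero shift, which is \<open>0\<close>.  So along every null sequence of radii the quotient of the mass of the ball
  around \<open>x0\<close> by the maximal mass has a lower bound tending to \<open>1\<close>; it never exceeds \<open>1\<close>
  (\<open>measure_ball_le_max_ball_mass\<close>), and the squeeze theorem concludes.
\<close>

lemma measure_ball_le_max_ball_mass:
  fixes \<mu> :: "'a::real_normed_vector measure"
  assumes "finite_measure \<mu>"
  shows "measure \<mu> (ball x \<delta>) \<le> max_ball_mass \<mu> \<delta>"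
proof -
  interpret finite_measure \<mu> by fact
  \<comment> \<open>the total mass bounds the masses of all balls, so the supremum is a genuine one\<close>
  have "bdd_above (range (\<lambda>x. measure \<mu> (ball x \<delta>)))"
    using bounded_measure by (intro bdd_aboveI2)
  then show ?thesis
    unfolding max_ball_mass_def by (intro cSUP_upper) auto
qed

text \<open>
  The ball around \<open>a - k\<close> has the mass that the measure shifted by \<open>k\<close> gives to the ball around
  \<open>a\<close>, and that mass is the integral of the density \<open>r\<close> over the ball around \<open>a\<close>.
\<close>
lemma measure_ball_translate_le:
  fixes \<mu> :: "'a::{real_normed_vector, second_countable_topology} measure"
  assumes "finite_measure \<mu>" and sets: "sets \<mu> = sets borel"
    and dens: "continuous_shift_density \<mu> k r"
    and r: "\<And>x. x \<in> ball a \<delta> \<Longrightarrow> r x \<le> c" and "0 \<le> c"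
  shows "measure \<mu> (ball (a - k) \<delta>) \<le> c * measure \<mu> (ball a \<delta>)"
proof -
  interpret finite_measure \<mu> by fact
  have "r \<in> borel_measurable borel"
    using dens unfolding continuous_shift_density_def
    by (intro borel_measurable_continuous_onI) auto
  then have [measurable]: "r \<in> borel_measurable \<mu>"
    using sets by (simp cong: measurable_cong_sets)
  have [measurable]: "ball a \<delta> \<in> sets \<mu>"
    by (simp add: sets)
  have "(\<lambda>y. y - k) ` ball a \<delta> = ball (a - k) \<delta>"
    using ball_translation_subtract[of a k \<delta>] by simp
  then have "emeasure \<mu> (ball (a - k) \<delta>) = emeasure (shifted_measure \<mu> k) (ball a \<delta>)"
    using emeasure_shifted_measure[OF sets, of "ball a \<delta>" k] by simp
  also have "\<dots> = emeasure (density \<mu> (\<lambda>x. ennreal (r x))) (ball a \<delta>)"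
    using dens by (simp add: continuous_shift_density_def)
  also have "\<dots> = (\<integral>\<^sup>+x. ennreal (r x) * indicator (ball a \<delta>) x \<partial>\<mu>)"
    by (rule emeasure_density) auto
  also have "\<dots> \<le> (\<integral>\<^sup>+x. ennreal c * indicator (ball a \<delta>) x \<partial>\<mu>)"
    using r by (intro nn_integral_mono) (force simp: indicator_def intro!: ennreal_leI)
  also have "\<dots> = ennreal c * emeasure \<mu> (ball a \<delta>)"
    by (rule nn_integral_cmult_indicator) simp
  finally show ?thesis
    using \<open>0 \<le> c\<close> by (simp add: emeasure_eq_measure flip: ennreal_mult)
qed

theorem theorem3p8:
  fixes \<mu> :: "'a::{banach, second_countable_topology} measure"
    and H :: "'a set"
    and \<iota> :: "'e::real_normed_vector \<Rightarrow> 'a"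
    and \<rho> :: "'e \<Rightarrow> 'a \<Rightarrow> real"
    and x0 :: 'a
  assumes "prob_space \<mu>" and "sets \<mu> = sets borel"
    and "subspace H" and "\<And>h. h \<in> H \<Longrightarrow> admissible_shift \<mu> h"
    and "bounded_linear \<iota>" and "inj \<iota>"
    and "range \<iota> \<subseteq> H" and "H \<subseteq> closure (range \<iota>)"
    and "\<And>h. continuous_shift_density \<mu> (\<iota> h) (\<rho> h)"
    and "\<rho> 0 = (\<lambda>x. 1)"
    and "generalized_mode \<mu> x0"
    and i: "\<And>\<delta>. (\<And>n. 0 < \<delta> n) \<Longrightarrow> \<delta> \<longlonglongrightarrow> 0 \<Longrightarrow>
          \<exists>w h. approximating_sequence \<mu> x0 \<delta> w \<and>
                (\<forall>n. w n = x0 + \<iota> (h n)) \<and> (\<lambda>n. norm (h n)) \<longlonglongrightarrow> 0"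
    and ii: "\<exists>R>0. (\<forall>h. bdd_above ((\<lambda>x. \<bar>\<rho> h x - 1\<bar>) ` ball x0 R)) \<and>
          isCont (\<lambda>h. SUP x\<in>ball x0 R. \<bar>\<rho> h x - 1\<bar>) 0"
  shows "strong_mode \<mu> x0"
proof -
  interpret prob_space \<mu> by fact
  from ii obtain R where "0 < R"
    and bdd: "\<And>h. bdd_above ((\<lambda>x. \<bar>\<rho> h x - 1\<bar>) ` ball x0 R)"
    and cont: "isCont (\<lambda>h. SUP x\<in>ball x0 R. \<bar>\<rho> h x - 1\<bar>) 0"
    by blast
  define f where "f h = (SUP x\<in>ball x0 R. \<bar>\<rho> h x - 1\<bar>)" for h
  have f_upper: "\<bar>\<rho> h x - 1\<bar> \<le> f h" if "x \<in> ball x0 R" for h x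
    unfolding f_def using bdd that by (rule cSUP_upper2) simp
  have f_nonneg: "0 \<le> f h" for h
    using f_upper[of x0 h] \<open>0 < R\<close> by simp
  have f0: "f 0 = 0"
    using \<open>\<rho> 0 = (\<lambda>x. 1)\<close> \<open>0 < R\<close> by (simp add: f_def)
  note max_le = measure_ball_le_max_ball_mass[OF finite_measure_axioms]
  have max_nonneg: "0 \<le> max_ball_mass \<mu> \<delta>" for \<delta>
    by (rule order.trans[OF measure_nonneg max_le])
  define q where "q \<delta> = measure \<mu> (ball x0 \<delta>) / max_ball_mass \<mu> \<delta>" for \<delta>
  have "(\<lambda>n. q (\<delta> n)) \<longlonglongrightarrow> 1" if pos: "\<And>n. 0 < \<delta> n" and lim: "\<delta> \<longlonglongrightarrow> 0" for \<delta>
  proof -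
    obtain w h where w: "approximating_sequence \<mu> x0 \<delta> w"
      and wh: "\<And>n. w n = x0 + \<iota> (h n)" and h: "(\<lambda>n. norm (h n)) \<longlonglongrightarrow> 0"
      using i[OF pos lim] by blast
    define p where "p n = measure \<mu> (ball (w n) (\<delta> n)) / max_ball_mass \<mu> (\<delta> n)" for n
    have p: "p \<longlonglongrightarrow> 1"
      using w by (simp add: approximating_sequence_def p_def[abs_def])
    have "(\<lambda>n. - h n) \<longlonglongrightarrow> 0"
      using h tendsto_minus[of h 0] by (simp add: tendsto_norm_zero_iff)
    then have "(\<lambda>n. f (- h n)) \<longlonglongrightarrow> 0"
      using isCont_tendsto_compose[OF cont] f0 by (simp add: f_def)
    with p have "(\<lambda>n. p n / (1 + f (- h n))) \<longlonglongrightarrow> 1 / (1 + 0)"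
      by (intro tendsto_intros) auto
    then have lower: "(\<lambda>n. p n / (1 + f (- h n))) \<longlonglongrightarrow> 1"
      by simp
    have "p n / (1 + f (- h n)) \<le> q (\<delta> n)" if "\<delta> n < R" for n
    proof -
      have "\<rho> (- h n) x \<le> 1 + f (- h n)" if "x \<in> ball x0 (\<delta> n)" for x
        using that \<open>\<delta> n < R\<close> f_upper[of x "- h n"] by auto
      then have "measure \<mu> (ball (x0 - \<iota> (- h n)) (\<delta> n))
          \<le> (1 + f (- h n)) * measure \<mu> (ball x0 (\<delta> n))"
        using measure_ball_translate_le[OF finite_measure_axioms \<open>sets \<mu> = sets borel\<close>]
          \<open>\<And>h. continuous_shift_density \<mu> (\<iota> h) (\<rho> h)\<close> add_nonneg_nonneg[OF zero_le_one f_nonneg] by blast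
      moreover have "x0 - \<iota> (- h n) = w n"
        using wh \<open>bounded_linear \<iota>\<close> by (simp add: linear_simps)
      ultimately have "p n \<le> (1 + f (- h n)) * q (\<delta> n)"
        unfolding p_def q_def times_divide_eq_right
        using max_nonneg by (intro divide_right_mono) auto
      then show ?thesis
        using f_nonneg[of "- h n"] by (simp add: pos_divide_le_eq mult.commute)
    qed
    then have "\<forall>\<^sub>F n in sequentially. p n / (1 + f (- h n)) \<le> q (\<delta> n)"
      using order_tendstoD(2)[OF lim \<open>0 < R\<close>] by (auto elim: eventually_mono)
    moreover have "\<forall>\<^sub>F n in sequentially. q (\<delta> n) \<le> 1"
      unfolding q_def using max_le[of x0] max_nonneg
      by (auto simp: divide_le_eq_1 less_le)
    ultimately show ?thesis
      using lower tendsto_const by (rule tendsto_sandwich)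
  qed
  then show ?thesis
    unfolding strong_mode_def tendsto_at_iff_sequentially q_def comp_def by auto
qed

end
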